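(* (a) For $d=2$: $\psi_{\mathbb{R}^2}(m)=m$ for every integer $m\geq 2$. (b) For every real $\varepsilon>0$ and every integer $d>2$: $\psi_{\mathbb{R}^d}(m)=O(m^{d+1+\varepsilon})$ as $m\to\infty$; that is, there exist constants $C>0$ and $m_0\in\mathbb{N}$ (depending only on $\varepsilon$ and $d$) such that $\psi_{\mathbb{R}^d}(m)\leq C\,m^{d+1+\varepsilon}$ for all integers $m\geq m_0$.
   Context: A direction is a nonzero vector $s\in\mathbb{R}^d$. For a finite set $F\subseteq\mathbb{R}^d$, the (discrete) X-ray of $F$ in direction $s$ is the function that assigns to each line parallel to $s$ the number of points of $F$ on that line. For $d\geq 2$, $\psi_{\mathbb{R}^d}(m)$ denotes the minimum number $n$ for which there exist $m$ directions $s_1,\dots,s_m$, pairwise linearly independent and spanning $\mathbb{R}^d$, such that there are two different $n$-point sets in $\mathbb{R}^d$ that have the same X-rays in each of the directions $s_1,\dots,s_m$. *)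

theory Defs
  imports "HOL-Analysis.Analysis"
begin

definition lines_parallel :: "real ^ 'd \<Rightarrow> (real ^ 'd) set set" where
  "lines_parallel s = {L. \<exists>x. L = {x + t *\<^sub>R s | t. True}}"

text \<open>Via \<^const>\<open>restrict\<close>, equality of X-rays means agreement on all lines parallel to
  the direction, and on nothing else. The direction \<open>s\<close> is meant to be nonzero.\<close>

definition xray :: "(real ^ 'd) set \<Rightarrow> real ^ 'd \<Rightarrow> ((real ^ 'd) set \<Rightarrow> nat)" where
  "xray F s = (\<lambda>L \<in> lines_parallel s. card (F \<inter> L))"

text \<open>Pairwise linearly independent vectors are distinct, so \<open>m\<close> directions form a set of
  cardinality \<open>m\<close>; \<^const>\<open>pairwise\<close> ranges over distinct elements of the set.\<close>

definition admissible_directions :: "nat \<Rightarrow> (real ^ 'd) set \<Rightarrow> bool" where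
  "admissible_directions m S \<longleftrightarrow>
     finite S \<and> card S = m \<and> 0 \<notin> S \<and>
     pairwise (\<lambda>s t. independent {s, t}) S \<and> span S = UNIV"

definition same_xrays_possible :: "'d::finite itself \<Rightarrow> nat \<Rightarrow> nat \<Rightarrow> bool" where
  "same_xrays_possible _ m n \<longleftrightarrow>
     (\<exists>(S :: (real ^ 'd) set) F G.
        admissible_directions m S \<and>
        finite F \<and> card F = n \<and> finite G \<and> card G = n \<and> F \<noteq> G \<and>
        (\<forall>s\<in>S. xray F s = xray G s))"

text \<open>The infimum in \<^typ>\<open>enat\<close> is the minimum if some \<open>n\<close> qualifies, and \<open>\<infinity>\<close> otherwise
  (for instance when \<open>m\<close> is less than the dimension). So a finite upper bound on \<open>\<psi>\<close> includes
  the existence of the minimum.\<close>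

definition psi :: "'d::finite itself \<Rightarrow> nat \<Rightarrow> enat" ("\<psi>") where
  "\<psi> d m = (INF n \<in> {n. same_xrays_possible d m n}. enat n)"

end

theory Submission
  imports Defs
begin

text \<open>
  Both parts rest on one construction and one counting argument.

  The vertices of a regular \<open>2q\<close>-gon, coloured alternately, form two \<open>q\<close>-point sets. The \<open>2q\<close>-gon
  has \<open>q\<close> axes of symmetry that pass through midpoints of its edges, and the reflection in each of
  them exchanges the two colours. A reflection moves every point along a fixed direction, the
  normal of the mirror, hence maps each line in that direction to itself; so the two colour
  classes have the same X-rays in \<open>q\<close> pairwise nonparallel directions
  (\<open>xray_eq_if_reflection_swaps\<close> is the general principle). For the plane this is
  an example with \<open>m\<close> points and \<open>m\<close> directions.

  In dimension \<open>d\<close> we take the product of the \<open>2q\<close>-gon with the cube \<open>{0,1}\<^sup>d\<^sup>-\<^sup>2\<close> and colour a vertex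
  by the parity of its position on the polygon plus the number of its cube coordinates equal to
  \<open>1\<close>. The \<open>q\<close> planar reflections still exchange the colours, and so do the \<open>d - 2\<close> reflections in the
  mid-hyperplanes of the cube, whose normals are coordinate axes. Thus \<open>m = q + (d - 2)\<close>
  spanning directions admit two sets of \<open>2\<^sup>d\<^sup>-\<^sup>2 q\<close> points each. For fixed \<open>d\<close> this is linear in \<open>m\<close>,
  far below the exponent \<open>d + 1 + \<epsilon>\<close>.

  For the lower bound in the plane, fix a point of one set that is not in the other: each
  of the \<open>m\<close> lines through it must meet the other set, and these \<open>m\<close> points are distinct.
\<close>

section \<open>A lower bound\<close>

text \<open>The \<open>m\<close> lines through a point \<open>p \<in> F - G\<close> have only \<open>p\<close> in common, and each of them contains a
  point of \<open>G\<close> because it contains a point of \<open>F\<close>.\<close>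

lemma same_xrays_imp_le:
  assumes "same_xrays_possible TYPE('d::finite) m n"
  shows "m \<le> n"
proof -
  obtain S F G where S: "admissible_directions m (S :: (real ^ 'd) set)"
    and fin: "finite F" "finite G" and card: "card F = n" "card G = n" and "F \<noteq> G"
    and xr: "\<And>s. s \<in> S \<Longrightarrow> xray F s = xray G s"
    using assms unfolding same_xrays_possible_def by blast
  have "\<not> F \<subseteq> G"
    using card_subset_eq[OF fin(2)] card \<open>F \<noteq> G\<close> by metis
  then obtain p where p: "p \<in> F" "p \<notin> G" by blast
  have "\<exists>t. p + t *\<^sub>R s \<in> G" if s: "s \<in> S" for s
  proof -
    define L where "L = {p + t *\<^sub>R s | t. True}"
    have "L \<in> lines_parallel s"
      unfolding L_def lines_parallel_def by blast
    then have "card (F \<inter> L) = card (G \<inter> L)"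
      using fun_cong[OF xr[OF s], of L] by (simp add: xray_def)
    moreover have "p \<in> L" unfolding L_def by (auto intro: exI[of _ 0])
    then have "F \<inter> L \<noteq> {}" using p by blast
    ultimately have "G \<inter> L \<noteq> {}" using fin by (metis card_0_eq finite_Int)
    then show ?thesis unfolding L_def by blast
  qed
  then obtain t where t: "\<And>s. s \<in> S \<Longrightarrow> p + t s *\<^sub>R s \<in> G" by metis
  have t0: "t s \<noteq> 0" if "s \<in> S" for s using t[OF that] p by auto
  have "inj_on (\<lambda>s. p + t s *\<^sub>R s) S"
  proof (rule inj_onI, rule ccontr)
    fix s s' assume s: "s \<in> S" "s' \<in> S" "p + t s *\<^sub>R s = p + t s' *\<^sub>R s'" "s \<noteq> s'"
    have "s = (t s' / t s) *\<^sub>R s'"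
      using s(3) t0[OF s(1)] vector_fraction_eq_iff[of "t s'" "t s" s' s] by auto
    then have "s \<in> span {s'}" by (metis insertI1 span_base span_scale)
    then have "dependent {s, s'}"
      unfolding dependent_def using s(4) by (intro bexI[of _ s]) (auto simp: insert_Diff_if)
    then show False
      using S s unfolding admissible_directions_def pairwise_def by blast
  qed
  then have "card S \<le> card G"
    using t fin(2) by (intro card_inj_on_le) auto
  then show ?thesis using S card by (simp add: admissible_directions_def)
qed

section \<open>Reflections and X-rays\<close>

text \<open>For a unit vector \<open>s\<close> this is the reflection in the hyperplane \<open>x \<bullet> s = c / 2\<close>. Linear
  mirrors have \<open>c = 0\<close>; the mid-hyperplane of the slab between coordinate values \<open>0\<close> and \<open>1\<close> has
  \<open>c = 1\<close>.\<close>

definition reflection :: "'a::real_inner \<Rightarrow> real \<Rightarrow> 'a \<Rightarrow> 'a" where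
  "reflection s c x = x - (2 * (x \<bullet> s) - c) *\<^sub>R s"

lemma reflection_involution:
  assumes "norm s = 1"
  shows "reflection s c (reflection s c x) = x"
proof -
  have "s \<bullet> s = 1" using assms by (simp add: dot_square_norm)
  then show ?thesis by (simp add: reflection_def inner_diff_left algebra_simps)
qed

text \<open>The reflection displaces points along \<open>s\<close> only, so on every line parallel to \<open>s\<close> it restricts to a
  bijection between the points of the two sets.\<close>

lemma xray_eq_if_reflection_swaps:
  assumes "norm s = 1" "reflection s c ` F \<subseteq> G" "reflection s c ` G \<subseteq> F"
  shows "xray F s = xray G s"
proof -
  have "card (F \<inter> L) = card (G \<inter> L)" if L: "L \<in> lines_parallel s" for L
  proof -
    have mem: "reflection s c y \<in> L" if "y \<in> L" for y
    proof -
      obtain x where x: "L = {x + t *\<^sub>R s | t. True}"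
        using L unfolding lines_parallel_def by blast
      then obtain t where "y = x + t *\<^sub>R s" using \<open>y \<in> L\<close> by blast
      then have "reflection s c y = x + (t - (2 * (y \<bullet> s) - c)) *\<^sub>R s"
        by (simp add: reflection_def algebra_simps)
      then show ?thesis using x by blast
    qed
    have "bij_betw (reflection s c) (F \<inter> L) (G \<inter> L)"
      by (rule bij_betw_byWitness[where f' = "reflection s c"])
        (use assms mem reflection_involution[OF assms(1)] in auto)
    then show ?thesis by (rule bij_betw_same_card)
  qed
  then show ?thesis unfolding xray_def by (intro restrict_ext)
qed

lemma independent_unit_vectors:
  fixes s t :: "'a::real_normed_vector"
  assumes "norm s = 1" "norm t = 1" "s \<noteq> t" "s \<noteq> - t"
  shows "independent {s, t}"
proof -
  have "s \<notin> span {t}"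
  proof
    assume "s \<in> span {t}"
    then obtain c where c: "s = c *\<^sub>R t" by (auto simp: span_singleton)
    then have "\<bar>c\<bar> = 1" using assms by simp
    then show False using c assms by (auto simp: abs_if split: if_splits)
  qed
  moreover have "independent {t}" using assms(2) by (auto simp: dependent_single)
  ultimately show ?thesis by (simp add: independent_insert)
qed

section \<open>The coloured prism\<close>

text \<open>The coordinates \<open>a\<close> and \<open>b\<close> span the plane of the polygon, the others carry the cube, and \<open>A\<close> is
  the set of cube coordinates equal to \<open>1\<close>. The position \<open>k\<close> on the polygon is any integer, so that
  a reflection is simply \<open>k \<mapsto> c - k\<close>; positions count modulo \<open>2q\<close>.\<close>

definition prism_vertex :: "'d \<Rightarrow> 'd \<Rightarrow> nat \<Rightarrow> int \<Rightarrow> 'd set \<Rightarrow> real ^ 'd" where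
  "prism_vertex a b q k A = (\<chi> i.
     if i = a then cos (pi * of_int k / of_nat q)
     else if i = b then sin (pi * of_int k / of_nat q)
     else of_bool (i \<in> A))"

text \<open>As \<open>2q\<close> is even, the parity of \<open>k\<close> depends only on the vertex. The two colour classes
  are \<open>e = 0\<close> and \<open>e = 1\<close>.\<close>

definition prism_class :: "'d::finite \<Rightarrow> 'd \<Rightarrow> nat \<Rightarrow> int \<Rightarrow> (real ^ 'd) set" where
  "prism_class a b q e =
     {prism_vertex a b q k A | k A. A \<subseteq> - {a, b} \<and> even (k + int (card A) + e)}"

text \<open>The unit normal of the mirror line at angle \<open>\<theta>\<close>.\<close>

definition planar_direction :: "'d \<Rightarrow> 'd \<Rightarrow> real \<Rightarrow> real ^ 'd" where
  "planar_direction a b \<theta> = (\<chi> i. if i = a then - sin \<theta> else if i = b then cos \<theta> else 0)"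

text \<open>The mirror halfway between the vertices at positions \<open>r\<close> and \<open>r + 1\<close>.\<close>

definition mirror_angle :: "nat \<Rightarrow> nat \<Rightarrow> real" where
  "mirror_angle q r = pi * (2 * real r + 1) / (2 * real q)"

definition prism_directions :: "'d::finite \<Rightarrow> 'd \<Rightarrow> nat \<Rightarrow> (real ^ 'd) set" where
  "prism_directions a b q =
     (\<lambda>r. planar_direction a b (mirror_angle q r)) ` {..<q} \<union> (\<lambda>j. axis j 1) ` (- {a, b})"

lemma prism_vertex_eq_iff:
  assumes "a \<noteq> b" "q > 0" "A \<subseteq> - {a, b}" "B \<subseteq> - {a, b}"
  shows "prism_vertex a b q k A = prism_vertex a b q l B \<longleftrightarrow>
    A = B \<and> k mod (2 * int q) = l mod (2 * int q)"
proof -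
  have "cos (pi * of_int k / of_nat q) = cos (pi * of_int l / of_nat q) \<and>
        sin (pi * of_int k / of_nat q) = sin (pi * of_int l / of_nat q) \<longleftrightarrow>
        (\<exists>n::int. pi * of_int k / of_nat q = pi * of_int l / of_nat q + 2 * pi * of_int n)"
    by (metis sin_cos_eq_iff)
  also have "\<dots> \<longleftrightarrow> (\<exists>n::int. k = l + 2 * int q * n)"
  proof (intro ex_cong1)
    fix n :: int
    have "pi * of_int k / of_nat q = pi * of_int l / of_nat q + 2 * pi * of_int n \<longleftrightarrow>
        pi * of_int k = pi * (of_int l + 2 * of_nat q * of_int n)"
      using assms(2) by (simp add: field_simps)
    also have "\<dots> \<longleftrightarrow> real_of_int k = of_int (l + 2 * int q * n)" by simp
    finally show "pi * of_int k / of_nat q = pi * of_int l / of_nat q + 2 * pi * of_int n \<longleftrightarrow>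
        k = l + 2 * int q * n" by (simp only: of_int_eq_iff)
  qed
  also have "\<dots> \<longleftrightarrow> k mod (2 * int q) = l mod (2 * int q)"
    by (simp add: mod_eq_dvd_iff dvd_def algebra_simps)
  finally have angles: "cos (pi * of_int k / of_nat q) = cos (pi * of_int l / of_nat q) \<and>
        sin (pi * of_int k / of_nat q) = sin (pi * of_int l / of_nat q) \<longleftrightarrow>
        k mod (2 * int q) = l mod (2 * int q)" .
  show ?thesis
  proof
    assume eq: "prism_vertex a b q k A = prism_vertex a b q l B"
    have *: "prism_vertex a b q k A $ i = prism_vertex a b q l B $ i" for i
      using eq by simp
    have "i \<in> A \<longleftrightarrow> i \<in> B" if "i \<noteq> a" "i \<noteq> b" for i
      using *[of i] that by (simp add: prism_vertex_def of_bool_def split: if_splits)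
    then have "A = B" using assms(3,4) by blast
    moreover have "cos (pi * of_int k / of_nat q) = cos (pi * of_int l / of_nat q)"
      "sin (pi * of_int k / of_nat q) = sin (pi * of_int l / of_nat q)"
      using *[of a] *[of b] assms(1) by (simp_all add: prism_vertex_def)
    ultimately show "A = B \<and> k mod (2 * int q) = l mod (2 * int q)"
      using angles by blast
  next
    assume "A = B \<and> k mod (2 * int q) = l mod (2 * int q)"
    then show "prism_vertex a b q k A = prism_vertex a b q l B"
      using angles by (auto simp: prism_vertex_def vec_eq_iff)
  qed
qed

text \<open>Within a class, \<open>A\<close> determines the parity of \<open>k\<close>, so each \<open>A\<close> leaves exactly \<open>q\<close> of the \<open>2q\<close>
  positions. This parametrization by \<open>{..<q} \<times> Pow (- {a, b})\<close>, which is injective, gives the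
  cardinality of the class.\<close>

lemma prism_class_image:
  assumes "a \<noteq> b" "q > 0"
  shows "prism_class a b q e =
    (\<lambda>(j, A). prism_vertex a b q (2 * int j - int (card A) - e) A) ` ({..<q} \<times> Pow (- {a, b}))"
    (is "_ = ?f ` ?X")
proof (rule set_eqI, rule iffI)
  fix x assume "x \<in> prism_class a b q e"
  then obtain k A where x: "x = prism_vertex a b q k A" and A: "A \<subseteq> - {a, b}"
    and ev: "even (k + int (card A) + e)"
    unfolding prism_class_def by blast
  from ev obtain l where l: "k + int (card A) + e = 2 * l" by blast
  define j where "j = nat (l mod int q)"
  have j: "int j = l mod int q" "j < q"
    using assms(2) by (simp_all add: j_def nat_less_iff)
  have "k - (2 * int j - int (card A) - e) = 2 * (l - l mod int q)"
    using l j(1) by simp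
  also have "\<dots> = 2 * int q * (l div int q)"
    by (simp add: minus_mod_eq_mult_div)
  finally have "k mod (2 * int q) = (2 * int j - int (card A) - e) mod (2 * int q)"
    unfolding mod_eq_dvd_iff by simp
  then have "x = ?f (j, A)"
    unfolding x prod.case prism_vertex_eq_iff[OF assms A A] by simp
  then show "x \<in> ?f ` ?X" using j(2) A by blast
next
  fix x assume "x \<in> ?f ` ?X"
  then obtain j A where x: "A \<subseteq> - {a, b}"
    "x = prism_vertex a b q (2 * int j - int (card A) - e) A" by auto
  have "even (2 * int j - int (card A) - e + int (card A) + e)" by simp
  then show "x \<in> prism_class a b q e"
    unfolding prism_class_def using x by (intro CollectI exI conjI)
qed

lemma card_Compl_doubleton:
  "a \<noteq> (b :: 'd::finite) \<Longrightarrow> card (- {a, b}) = CARD('d) - 2"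
  unfolding Compl_eq_Diff_UNIV by (subst card_Diff_subset) auto

lemma card_prism_class:
  assumes "a \<noteq> (b :: 'd::finite)" "q > 0"
  shows "finite (prism_class a b q e)" "card (prism_class a b q e) = q * 2 ^ (CARD('d) - 2)"
proof -
  show "finite (prism_class a b q e)"
    unfolding prism_class_image[OF assms] by simp
  have "inj_on (\<lambda>(j, A). prism_vertex a b q (2 * int j - int (card A) - e) A)
      ({..<q} \<times> Pow (- {a, b}))"
  proof (rule inj_onI, clarsimp)
    fix i j A B
    assume *: "i < q" "j < q" "A \<subseteq> - {a, b}" "B \<subseteq> - {a, b}"
      "prism_vertex a b q (2 * int i - int (card A) - e) A =
       prism_vertex a b q (2 * int j - int (card B) - e) B"
    then have AB: "A = B" and "2 * int q dvd 2 * (int i - int j)"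
      using prism_vertex_eq_iff[OF assms *(3,4)] by (auto simp: mod_eq_dvd_iff algebra_simps)
    then have "2 * int q dvd 2 * (int i - int j)" by blast
    then have "int q dvd int i - int j"
      by (simp only: dvd_mult_cancel_left) simp
    then have "int i mod int q = int j mod int q" by (simp add: mod_eq_dvd_iff)
    then show "i = j \<and> A = B" using *(1,2) AB by simp
  qed
  then have "card (prism_class a b q e) = q * 2 ^ card (- {a, b})"
    unfolding prism_class_image[OF assms] by (simp add: card_image card_cartesian_product card_Pow)
  then show "card (prism_class a b q e) = q * 2 ^ (CARD('d) - 2)"
    using assms(1) by (simp add: card_Compl_doubleton)
qed

lemma prism_class_distinct:
  assumes "a \<noteq> (b :: 'd::finite)" "q > 0"
  shows "prism_class a b q 0 \<noteq> prism_class a b q 1"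
proof
  assume eq: "prism_class a b q 0 = prism_class a b q 1"
  have "prism_vertex a b q 0 {} \<in> prism_class a b q 0"
    unfolding prism_class_def by (rule CollectI, rule exI[of _ 0], rule exI[of _ "{}"]) simp
  then obtain k A where k: "prism_vertex a b q 0 {} = prism_vertex a b q k A"
    "A \<subseteq> - {a, b}" "even (k + int (card A) + 1)"
    unfolding eq unfolding prism_class_def by blast
  then have "A = {}" "2 * int q dvd k"
    using prism_vertex_eq_iff[OF assms _ k(2), of "{}" 0 k] by auto
  then have "even k" by (meson dvd_trans dvd_triv_left)
  then show False using k(3) \<open>A = {}\<close> by simp
qed

lemma norm_planar_direction:
  assumes "a \<noteq> (b :: 'd::finite)"
  shows "norm (planar_direction a b \<theta>) = 1"
proof -
  have "(\<Sum>i\<in>UNIV. (planar_direction a b \<theta> $ i)\<^sup>2) =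
      (\<Sum>i\<in>{a, b}. (planar_direction a b \<theta> $ i)\<^sup>2)"
    by (rule sum.mono_neutral_right) (auto simp: planar_direction_def)
  also have "\<dots> = 1" using assms by (simp add: planar_direction_def)
  finally show ?thesis by (simp add: norm_vec_def L2_set_def)
qed

lemma inner_prism_vertex_planar_direction:
  assumes "a \<noteq> (b :: 'd::finite)"
  shows "prism_vertex a b q k A \<bullet> planar_direction a b \<theta> = sin (pi * of_int k / of_nat q - \<theta>)"
proof -
  have "prism_vertex a b q k A \<bullet> planar_direction a b \<theta> =
      (\<Sum>i\<in>{a, b}. prism_vertex a b q k A $ i * planar_direction a b \<theta> $ i)"
    unfolding inner_vec_def inner_real_def
    by (rule sum.mono_neutral_right) (auto simp: planar_direction_def)
  also have "\<dots> = sin (pi * of_int k / of_nat q - \<theta>)"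
    using assms by (simp add: planar_direction_def prism_vertex_def sin_diff)
  finally show ?thesis .
qed

text \<open>In terms of angles the reflection is \<open>\<alpha> \<mapsto> 2\<theta> - \<alpha>\<close>, and twice the mirror angle is the angle
  of position \<open>2r + 1\<close>. Since \<open>2r + 1\<close> is odd, the parity of the position changes.\<close>

lemma reflection_planar_direction:
  assumes "a \<noteq> (b :: 'd::finite)" "q > 0"
  shows "reflection (planar_direction a b (mirror_angle q r)) 0 (prism_vertex a b q k A) =
    prism_vertex a b q (2 * int r + 1 - k) A"
proof -
  define \<theta> \<alpha> where "\<theta> = mirror_angle q r" and "\<alpha> = pi * of_int k / of_nat q"
  have ang: "pi * of_int (2 * int r + 1 - k) / of_nat q = 2 * \<theta> - \<alpha>"
    using assms(2) by (simp add: \<theta>_def \<alpha>_def mirror_angle_def field_simps)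
  \<comment> \<open>Both sides are expanded in terms of \<open>\<theta>\<close> and the angle \<open>\<alpha> - \<theta>\<close> to the mirror.\<close>
  have "cos (2 * \<theta> - \<alpha>) = cos (\<theta> - (\<alpha> - \<theta>))" "sin (2 * \<theta> - \<alpha>) = sin (\<theta> - (\<alpha> - \<theta>))"
       "cos \<alpha> = cos (\<theta> + (\<alpha> - \<theta>))" "sin \<alpha> = sin (\<theta> + (\<alpha> - \<theta>))"
    by (simp_all add: algebra_simps)
  then have "cos \<alpha> + 2 * sin (\<alpha> - \<theta>) * sin \<theta> = cos (2 * \<theta> - \<alpha>)"
    and "sin \<alpha> - 2 * sin (\<alpha> - \<theta>) * cos \<theta> = sin (2 * \<theta> - \<alpha>)"
    by (simp_all only: cos_add cos_diff[of \<theta> "\<alpha> - \<theta>"] sin_add sin_diff[of \<theta> "\<alpha> - \<theta>"])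
      (simp_all add: algebra_simps)
  then show ?thesis
    unfolding reflection_def inner_prism_vertex_planar_direction[OF assms(1)]
      vec_eq_iff \<theta>_def[symmetric] \<alpha>_def[symmetric]
    using assms(1) unfolding prism_vertex_def planar_direction_def ang \<alpha>_def[symmetric]
    by (auto simp: algebra_simps)
qed

lemma reflection_axis:
  assumes "j \<notin> {a, b :: 'd::finite}"
  shows "reflection (axis j 1) 1 (prism_vertex a b q k A) =
    prism_vertex a b q k (if j \<in> A then A - {j} else insert j A)"
  using assms
  by (auto simp: reflection_def inner_axis vec_eq_iff prism_vertex_def)
    (auto simp: axis_def)

lemma prism_directions_xray_eq:
  assumes "a \<noteq> (b :: 'd::finite)" "q > 0" "s \<in> prism_directions a b q"
  shows "xray (prism_class a b q 0) s = xray (prism_class a b q 1) s"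
proof -
  consider r where "s = planar_direction a b (mirror_angle q r)"
    | j where "j \<notin> {a, b}" "s = axis j 1"
    using assms(3) unfolding prism_directions_def by blast
  then show ?thesis
  proof cases
    case 1
    have swap: "reflection s 0 ` prism_class a b q e \<subseteq> prism_class a b q e'"
      if "odd (e + e')" for e e'
    proof (rule image_subsetI)
      fix x assume "x \<in> prism_class a b q e"
      then obtain k A where x: "x = prism_vertex a b q k A" "A \<subseteq> - {a, b}"
        "even (k + int (card A) + e)" unfolding prism_class_def by blast
      have "reflection s 0 x = prism_vertex a b q (2 * int r + 1 - k) A"
        using reflection_planar_direction[OF assms(1,2)] x(1) 1 by simp
      moreover have "even (2 * int r + 1 - k + int (card A) + e')"
        using x(3) that by simp presburger
      ultimately show "reflection s 0 x \<in> prism_class a b q e'"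
        unfolding prism_class_def using x(2) by blast
    qed
    show ?thesis
      using norm_planar_direction[OF assms(1)] 1 swap
      by (intro xray_eq_if_reflection_swaps[of s 0]) auto
  next
    case 2
    have swap: "reflection s 1 ` prism_class a b q e \<subseteq> prism_class a b q e'"
      if "odd (e + e')" for e e'
    proof (rule image_subsetI)
      fix x assume "x \<in> prism_class a b q e"
      then obtain k A where x: "x = prism_vertex a b q k A" "A \<subseteq> - {a, b}"
        "even (k + int (card A) + e)" unfolding prism_class_def by blast
      define B where "B = (if j \<in> A then A - {j} else insert j A)"
      have "reflection s 1 x = prism_vertex a b q k B"
        using reflection_axis[OF 2(1)] x(1) 2(2) by (simp add: B_def)
      moreover have "B \<subseteq> - {a, b}" using x(2) 2(1) by (auto simp: B_def)
      moreover have "card B + 1 = card A \<or> card B = card A + 1"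
        using card.remove[of A j] by (auto simp: B_def)
      then have "even (k + int (card B) + e')"
        using x(3) that by presburger
      ultimately show "reflection s 1 x \<in> prism_class a b q e'"
        unfolding prism_class_def by blast
    qed
    show ?thesis
      using 2 swap by (intro xray_eq_if_reflection_swaps[of s 1]) auto
  qed
qed

section \<open>Admissibility\<close>

lemma mirror_angle_bounds:
  assumes "r < q"
  shows "0 < mirror_angle q r" "mirror_angle q r < pi"
proof -
  have "2 * real r + 1 < 2 * real q" using assms by linarith
  then show "0 < mirror_angle q r" "mirror_angle q r < pi"
    using assms by (simp_all add: mirror_angle_def divide_less_eq)
qed

lemma inj_on_planar_direction:
  assumes "a \<noteq> (b :: 'd::finite)"
  shows "inj_on (\<lambda>r. planar_direction a b (mirror_angle q r)) {..<q}"
proof (rule inj_onI)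
  fix r r' assume r: "r \<in> {..<q}" "r' \<in> {..<q}"
    and eq: "planar_direction a b (mirror_angle q r) = planar_direction a b (mirror_angle q r')"
  from eq have "planar_direction a b (mirror_angle q r) $ b =
      planar_direction a b (mirror_angle q r') $ b" by simp
  then have "cos (mirror_angle q r) = cos (mirror_angle q r')"
    using assms by (simp add: planar_direction_def)
  then have "mirror_angle q r = mirror_angle q r'"
    using mirror_angle_bounds[of r q] mirror_angle_bounds[of r' q] r
    by (meson cos_inj_pi lessThan_iff less_imp_le)
  then have "pi * (2 * real r + 1) = pi * (2 * real r' + 1)"
    using r by (simp add: mirror_angle_def)
  then show "r = r'" by simp
qed

text \<open>The sign of this coordinate tells planar directions from coordinate axes, and excludes
  that two of them are opposite.\<close>

lemma planar_direction_nth_neg: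
  assumes "r < q"
  shows "planar_direction a b (mirror_angle q r) $ a < 0"
  using sin_gt_zero[OF mirror_angle_bounds[OF assms]] by (simp add: planar_direction_def)

lemma card_prism_directions:
  assumes "a \<noteq> (b :: 'd::finite)"
  shows "card (prism_directions a b q) = q + (CARD('d) - 2)"
proof -
  have "(\<lambda>r. planar_direction a b (mirror_angle q r)) ` {..<q} \<inter>
      (\<lambda>j. axis j 1) ` (- {a, b}) = {}"
  proof -
    have "planar_direction a b (mirror_angle q r) \<noteq> axis j 1" if "r < q" "j \<noteq> a" for r j
      using planar_direction_nth_neg[OF that(1), of a b] that(2) by (auto simp: axis_def)
    then show ?thesis by auto
  qed
  moreover have "inj_on (\<lambda>j::'d. axis j (1::real)) (- {a, b})"
    by (auto simp: inj_on_def axis_eq_axis)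
  ultimately show ?thesis
    unfolding prism_directions_def using assms
    by (simp add: card_Un_disjoint card_image inj_on_planar_direction card_Compl_doubleton)
qed

text \<open>Two planar directions at angles \<open>\<theta>\<close>, \<open>\<theta>'\<close> combine to \<open>sin (\<theta>' - \<theta>)\<close> times either axis of the
  plane, and two neighbouring mirrors enclose the angle \<open>\<pi> / q < \<pi>\<close>.\<close>

lemma span_prism_directions:
  assumes "a \<noteq> (b :: 'd::finite)" "q \<ge> 2"
  shows "span (prism_directions a b q) = UNIV"
proof -
  let ?S = "prism_directions a b q"
  define \<theta> \<theta>' where "\<theta> = mirror_angle q 0" and "\<theta>' = mirror_angle q 1"
  define \<delta> where "\<delta> = sin (\<theta>' - \<theta>)"
  have "\<theta>' - \<theta> = pi / real q"
    using assms(2) by (simp add: \<theta>_def \<theta>'_def mirror_angle_def field_simps)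
  moreover have "pi / real q < pi" using assms(2) by (simp add: divide_less_eq)
  ultimately have \<delta>: "\<delta> > 0"
    unfolding \<delta>_def using assms(2) by (intro sin_gt_zero) auto
  have mem: "planar_direction a b \<theta> \<in> span ?S" "planar_direction a b \<theta>' \<in> span ?S"
    using assms(2) by (auto intro!: span_base simp: prism_directions_def \<theta>_def \<theta>'_def)
  have a: "\<delta> *\<^sub>R axis a 1 =
      cos \<theta>' *\<^sub>R planar_direction a b \<theta> - cos \<theta> *\<^sub>R planar_direction a b \<theta>'"
    using assms(1)
    by (auto simp: vec_eq_iff planar_direction_def axis_def \<delta>_def sin_diff algebra_simps)
  have b: "\<delta> *\<^sub>R axis b 1 =
      sin \<theta>' *\<^sub>R planar_direction a b \<theta> - sin \<theta> *\<^sub>R planar_direction a b \<theta>'"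
    using assms(1)
    by (auto simp: vec_eq_iff planar_direction_def axis_def \<delta>_def sin_diff algebra_simps)
  have "\<delta> *\<^sub>R axis a 1 \<in> span ?S" "\<delta> *\<^sub>R axis b 1 \<in> span ?S"
    unfolding a b by (intro span_diff span_scale mem)+
  from this[THEN span_scale, of "1 / \<delta>"]
  have ab: "axis a 1 \<in> span ?S" "axis b 1 \<in> span ?S"
    using \<delta> by simp_all
  have "axis j 1 \<in> span ?S" for j
    using ab by (cases "j \<in> {a, b}") (auto intro: span_base simp: prism_directions_def)
  then have "Basis \<subseteq> span ?S" by (auto simp: Basis_vec_def)
  then have "span Basis \<subseteq> span ?S" by (rule span_minimal) (rule subspace_span)
  then show ?thesis by auto
qed

lemma prism_directions_admissible:
  assumes "a \<noteq> (b :: 'd::finite)" "q \<ge> 2"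
  shows "admissible_directions (q + (CARD('d) - 2)) (prism_directions a b q)"
proof -
  let ?S = "prism_directions a b q"
  have norm: "norm s = 1" if "s \<in> ?S" for s
    using that norm_planar_direction[OF assms(1)] by (auto simp: prism_directions_def)
  have opposite: "s \<noteq> - t" if mem: "s \<in> ?S" "t \<in> ?S" for s t
  proof
    assume st: "s = - t"
    have *: "u $ a < 0 \<or> (\<exists>j. j \<noteq> a \<and> u = axis j 1)" if "u \<in> ?S" for u
      using that planar_direction_nth_neg[of _ q a b] by (auto simp: prism_directions_def)
    have "s $ a = - t $ a" using st by simp
    then obtain i j where "s = axis i 1" "t = axis j 1"
      using *[OF mem(1)] *[OF mem(2)] by (auto simp: axis_def)
    then have "s $ i = 1" "t $ i \<ge> 0" by (auto simp: axis_def)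
    then show False using st by simp
  qed
  have "finite ?S" by (simp add: prism_directions_def)
  moreover have "0 \<notin> ?S" using norm by force
  moreover have "pairwise (\<lambda>s t. independent {s, t}) ?S"
    unfolding pairwise_def using norm opposite independent_unit_vectors by blast
  ultimately show ?thesis
    unfolding admissible_directions_def
    using card_prism_directions[OF assms(1)] span_prism_directions[OF assms] by simp
qed

lemma prism_same_xrays_possible:
  assumes "CARD('d::finite) \<ge> 2" "q \<ge> 2"
  shows "same_xrays_possible TYPE('d) (q + (CARD('d) - 2)) (q * 2 ^ (CARD('d) - 2))"
proof -
  obtain a b :: 'd where ab: "a \<noteq> b"
    using assms(1) card_le_Suc0_iff_eq[of "UNIV :: 'd set"] by force
  have q: "q > 0" using assms(2) by simp
  show ?thesis
    unfolding same_xrays_possible_def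
    using prism_directions_admissible[OF ab assms(2)] card_prism_class[OF ab q]
      prism_class_distinct[OF ab q] prism_directions_xray_eq[OF ab q] by blast
qed

section \<open>Bounds for the minimal size\<close>

theorem corollary4p1:
  shows "(\<forall>m\<ge>2. \<psi> TYPE(2) m = enat m) \<and>
    (CARD('d::finite) > 2 \<longrightarrow>
      (\<forall>\<epsilon>::real. \<epsilon> > 0 \<longrightarrow>
        (\<exists>C::real. \<exists>m\<^sub>0::nat. C > 0 \<and>
          (\<forall>m\<ge>m\<^sub>0. ereal_of_enat (\<psi> TYPE('d) m)
             \<le> ereal (C * real m powr (real CARD('d) + 1 + \<epsilon>))))))"
proof (intro conjI impI allI)
  fix m :: nat assume m: "m \<ge> 2"
  show "\<psi> TYPE(2) m = enat m"
  proof (rule antisym)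
    have "same_xrays_possible TYPE(2) m m"
      using prism_same_xrays_possible[where 'd = 2, OF _ m] by simp
    then show "\<psi> TYPE(2) m \<le> enat m"
      unfolding psi_def by (intro INF_lower) simp
    show "enat m \<le> \<psi> TYPE(2) m"
      unfolding psi_def by (intro INF_greatest) (auto dest: same_xrays_imp_le)
  qed
next
  fix \<epsilon> :: real assume d: "CARD('d) > 2" and \<epsilon>: "\<epsilon> > 0"
  define D where "D = CARD('d) - 2"
  show "\<exists>C::real. \<exists>m\<^sub>0::nat. C > 0 \<and> (\<forall>m\<ge>m\<^sub>0. ereal_of_enat (\<psi> TYPE('d) m)
             \<le> ereal (C * real m powr (real CARD('d) + 1 + \<epsilon>)))"
  proof (intro exI conjI allI impI)
    show "(2::real) ^ D > 0" by simp
    fix m :: nat assume m: "m \<ge> CARD('d)"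
    define q where "q = m - D"
    have q: "q \<ge> 2" "m = q + D" using m d by (auto simp: q_def D_def)
    have "same_xrays_possible TYPE('d) m (q * 2 ^ D)"
      using prism_same_xrays_possible[where 'd = 'd, OF _ q(1)] d q(2) by (simp add: D_def)
    then have "\<psi> TYPE('d) m \<le> enat (q * 2 ^ D)"
      unfolding psi_def by (intro INF_lower) simp
    then have "ereal_of_enat (\<psi> TYPE('d) m) \<le> ereal (real (q * 2 ^ D))"
      by (metis ereal_of_enat_le_iff ereal_of_enat_simps(1))
    also have "real (q * 2 ^ D) \<le> 2 ^ D * real m powr (real CARD('d) + 1 + \<epsilon>)"
    proof -
      have "real q \<le> real m powr 1" using q by simp
      also have "\<dots> \<le> real m powr (real CARD('d) + 1 + \<epsilon>)"
        using q \<epsilon> by (intro powr_mono) auto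
      finally show ?thesis by (simp add: mult.commute)
    qed
    finally show "ereal_of_enat (\<psi> TYPE('d) m)
        \<le> ereal (2 ^ D * real m powr (real CARD('d) + 1 + \<epsilon>))" by simp
  qed
qed

end
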